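(* Border rank is not multiplicative under the tensor product: there exist tensors $T_1 \in V_1 \otimes \cdots \otimes V_{k_1}$ and $T_2 \in W_1 \otimes \cdots \otimes W_{k_2}$ over $\mathbb{C}$ such that $\underline{\mathrm{R}}(T_1 \otimes T_2) < \underline{\mathrm{R}}(T_1)\,\underline{\mathrm{R}}(T_2)$.
   Context: All vector spaces are finite-dimensional over $\mathbb{C}$. For $T \in V_1 \otimes \cdots \otimes V_k$, the tensor rank $\mathrm{R}(T)$ is the minimum $r$ such that $T = \sum_{i=1}^r v_1^{(i)} \otimes \cdots \otimes v_k^{(i)}$ with $v_j^{(i)} \in V_j$. The border rank $\underline{\mathrm{R}}(T)$ is the minimum $r$ such that $T = \lim_{\varepsilon \to 0} T_\varepsilon$ (Euclidean topology) with $\mathrm{R}(T_\varepsilon) = r$ for every $\varepsilon$. For tensors $T_1 \in V_1 \otimes \cdots \otimes V_{k_1}$ and $T_2 \in W_1 \otimes \cdots \otimes W_{k_2}$ of orders $k_1,k_2$, the tensor product $T_1 \otimes T_2$ is regarded as a tensor of order $k_1+k_2$ in $V_1 \otimes \cdots \otimes V_{k_1} \otimes W_1 \otimes \cdots \otimes W_{k_2}$ (the factors are not grouped), and its border rank is taken as an order-$(k_1+k_2)$ tensor. *)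

theory Defs
  imports Complex_Main
begin

text \<open>
  Every finite-dimensional complex vector space is taken in coordinates, as \<open>\<complex>\<^sup>d\<close>.
  A list \<open>ds = [d\<^sub>1, \<dots>, d\<^sub>k]\<close> of dimensions, which may differ from each other, stands for the
  spaces \<open>V\<^sub>1 = \<complex>\<^bsup>d\<^sub>1\<^esup>, \<dots>, V\<^sub>k = \<complex>\<^bsup>d\<^sub>k\<^esup>\<close>, and a tensor in \<open>V\<^sub>1 \<otimes> \<dots> \<otimes> V\<^sub>k\<close> is its array of
  coefficients with respect to the basis of products of standard basis vectors: a function of
  multi-indices \<open>[i\<^sub>1, \<dots>, i\<^sub>k]\<close> with \<open>i\<^sub>j < d\<^sub>j\<close>. Vectors and tensors are zero outside their index
  range, so that equality in the space is equality of functions.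
\<close>

type_synonym tensor = "nat list \<Rightarrow> complex"

definition coord_space :: "nat \<Rightarrow> (nat \<Rightarrow> complex) set" where
  "coord_space d = {v. \<forall>i. d \<le> i \<longrightarrow> v i = 0}"

definition multi_indices :: "nat list \<Rightarrow> nat list set" where
  "multi_indices ds = {is. length is = length ds \<and> (\<forall>j < length ds. is ! j < ds ! j)}"

definition tensor_space :: "nat list \<Rightarrow> tensor set" where
  "tensor_space ds = {T. \<forall>is. is \<notin> multi_indices ds \<longrightarrow> T is = 0}"

text \<open>\<open>v\<^sub>1 \<otimes> \<dots> \<otimes> v\<^sub>k\<close>\<close>

definition elementary_tensor :: "(nat \<Rightarrow> complex) list \<Rightarrow> tensor" where
  "elementary_tensor vs =
     (\<lambda>is. if length is = length vs then \<Prod>j < length vs. (vs ! j) (is ! j) else 0)"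

definition is_sum_of_elementary :: "nat list \<Rightarrow> tensor \<Rightarrow> nat \<Rightarrow> bool" where
  "is_sum_of_elementary ds T r \<longleftrightarrow>
     (\<exists>v :: nat \<Rightarrow> (nat \<Rightarrow> complex) list.
        (\<forall>i < r. length (v i) = length ds \<and>
           (\<forall>j < length ds. v i ! j \<in> coord_space (ds ! j))) \<and>
        T = (\<lambda>is. \<Sum>i < r. elementary_tensor (v i) is))"

text \<open>
  The minima below are over nonempty sets when \<open>ds \<noteq> []\<close> and \<open>T \<in> tensor_space ds\<close>. Order 0 is
  degenerate: the empty product is 1, so only natural numbers are sums of elementary tensors.
\<close>

definition tensor_rank :: "nat list \<Rightarrow> tensor \<Rightarrow> nat" where
  "tensor_rank ds T = (LEAST r. is_sum_of_elementary ds T r)"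

text \<open>
  Only finitely many coefficients of tensors in a given space can be nonzero, so convergence of
  each coefficient is convergence in the Euclidean topology.
\<close>

definition is_limit_of_rank :: "nat list \<Rightarrow> tensor \<Rightarrow> nat \<Rightarrow> bool" where
  "is_limit_of_rank ds T r \<longleftrightarrow>
     (\<exists>S :: real \<Rightarrow> tensor.
        (\<forall>\<epsilon> > 0. S \<epsilon> \<in> tensor_space ds \<and> tensor_rank ds (S \<epsilon>) = r) \<and>
        (\<forall>is. ((\<lambda>\<epsilon>. S \<epsilon> is) \<longlongrightarrow> T is) (at_right 0)))"

definition border_rank :: "nat list \<Rightarrow> tensor \<Rightarrow> nat" where
  "border_rank ds T = (LEAST r. is_limit_of_rank ds T r)"

text \<open>
  For \<open>T\<^sub>1\<close> of order \<open>k\<close>, the ungrouped tensor product, an element of \<open>tensor_space (ds\<^sub>1 @ ds\<^sub>2)\<close>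
  when \<open>T\<^sub>1 \<in> tensor_space ds\<^sub>1\<close>, \<open>k = length ds\<^sub>1\<close> and \<open>T\<^sub>2 \<in> tensor_space ds\<^sub>2\<close>.
\<close>

definition tensor_product :: "nat \<Rightarrow> tensor \<Rightarrow> tensor \<Rightarrow> tensor" where
  "tensor_product k T\<^sub>1 T\<^sub>2 = (\<lambda>is. T\<^sub>1 (take k is) * T\<^sub>2 (drop k is))"

end

theory Submission imports Defs begin

text \<open>
  Let \<open>C\<close> and \<open>F\<close> be tensors in the same space and put \<open>D = C + F / 2\<close>, \<open>T = C + F\<close>. Then
  \<open>T \<otimes> T = C \<otimes> C + F \<otimes> D + D \<otimes> F\<close>. So if \<open>F\<close> is elementary and \<open>C\<close> and \<open>D\<close> are both sums of four
  elementary tensors, then \<open>T \<otimes> T\<close> is a sum of \<open>16 + 4 + 4 = 24\<close> of them, so its rank, and a fortiori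
  its border rank, is at most 24. It remains to find such a line \<open>C + s F\<close> on which \<open>T\<close> has border
  rank at least 5, because \<open>24 < 25\<close>.

  Why such lines exist: in \<open>\<complex>\<^sup>3 \<otimes> \<complex>\<^sup>3 \<otimes> \<complex>\<^sup>3\<close>, tensors of border rank at most 4 form the zero set
  of Strassen's determinant, the determinant of a 9 by 9 matrix that depends linearly on the tensor.
  An elementary tensor \<open>F\<close> contributes a matrix of rank 2, so on a line with direction \<open>F\<close> the
  determinant is a polynomial of degree at most 2 in \<open>s\<close>, generically with two roots. Reparametrising
  the line puts these roots at \<open>s = 0\<close> and \<open>s = 1 / 2\<close>.

  The line used here, \<open>line_tensor\<close>, has as its three slices the matrices
  \<open>diag(1, 0, 2 s - 1)\<close>, the cyclic permutation matrix \<open>N\<close>, and \<open>diag(0, 1, s)\<close>. At \<open>s = 0\<close> and at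
  \<open>s = 1 / 2\<close>, one elementary tensor can be split off so that what remains is a pencil spanned by
  an invertible diagonal matrix and \<open>N\<close>. Such a pencil is diagonalised by the discrete Fourier
  transform after rescaling rows and columns, so it is a sum of three elementary tensors
  (\<open>cyclic_pencil\<close>).

  The lower bound (\<open>border_rank_gt_if_koszul_bounded_below\<close>) is Strassen's, with kernel vectors in
  place of the determinant: a sum of four elementary tensors has a Koszul flattening with
  nontrivial kernel, whereas that of \<open>T\<close> is bounded below, which is an open condition.
\<close>

section \<open>Sums of elementary tensors\<close>

lemma is_sum_of_elementaryI:
  assumes "finite I" "card I = r"
    and "\<And>i. i \<in> I \<Longrightarrow> length (v i) = length ds"
    and "\<And>i j. i \<in> I \<Longrightarrow> j < length ds \<Longrightarrow> v i ! j \<in> coord_space (ds ! j)"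
    and "\<And>is. T is = (\<Sum>i\<in>I. elementary_tensor (v i) is)"
  shows "is_sum_of_elementary ds T r"
proof -
  obtain h where h: "bij_betw h {..<r} I"
    using ex_bij_betw_nat_finite[OF assms(1)] assms(2) by (auto simp: atLeast0LessThan)
  have "T = (\<lambda>is. \<Sum>i<r. elementary_tensor (v (h i)) is)"
    using assms(5) by (auto simp: fun_eq_iff intro!: sum.reindex_bij_betw[OF h, symmetric])
  moreover have "h i \<in> I" if "i < r" for i
    using h that by (auto simp: bij_betw_def)
  ultimately show ?thesis
    unfolding is_sum_of_elementary_def using assms(3,4)
    by (intro exI[of _ "\<lambda>i. v (h i)"]) auto
qed

lemma is_sum_of_elementary_add:
  assumes "is_sum_of_elementary ds T r" "is_sum_of_elementary ds U s"
  shows "is_sum_of_elementary ds (\<lambda>is. T is + U is) (r + s)"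
proof -
  obtain v where v: "\<And>i. i < r \<Longrightarrow> length (v i) = length ds"
      "\<And>i j. i < r \<Longrightarrow> j < length ds \<Longrightarrow> v i ! j \<in> coord_space (ds ! j)"
      "T = (\<lambda>is. \<Sum>i<r. elementary_tensor (v i) is)"
    using assms(1) unfolding is_sum_of_elementary_def by blast
  obtain w where w: "\<And>i. i < s \<Longrightarrow> length (w i) = length ds"
      "\<And>i j. i < s \<Longrightarrow> j < length ds \<Longrightarrow> w i ! j \<in> coord_space (ds ! j)"
      "U = (\<lambda>is. \<Sum>i<s. elementary_tensor (w i) is)"
    using assms(2) unfolding is_sum_of_elementary_def by blast
  show ?thesis
    by (rule is_sum_of_elementaryI[where I = "{..<r} <+> {..<s}" and v = "case_sum v w"])
       (auto simp: v w card_Plus sum.Plus)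
qed

lemma elementary_tensor_append:
  "elementary_tensor (vs @ ws) =
     tensor_product (length vs) (elementary_tensor vs) (elementary_tensor ws)"
proof
  fix "is" :: "nat list"
  show "elementary_tensor (vs @ ws) is =
     tensor_product (length vs) (elementary_tensor vs) (elementary_tensor ws) is"
  proof (cases "length is = length vs + length ws")
    case True
    let ?f = "\<lambda>j. ((vs @ ws) ! j) (is ! j)"
    have "prod ?f {..<length vs + n} = prod ?f {..<length vs} * (\<Prod>j<n. ?f (length vs + j))" for n
      by (induction n) (simp_all add: mult.assoc)
    moreover have "prod ?f {..<length vs} = (\<Prod>j<length vs. (vs ! j) (take (length vs) is ! j))"
      by (rule prod.cong) (simp_all add: nth_append)
    moreover have "(\<Prod>j<length ws. ?f (length vs + j))
        = (\<Prod>j<length ws. (ws ! j) (drop (length vs) is ! j))"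
      using True by (intro prod.cong) (simp_all add: nth_append)
    ultimately show ?thesis
      using True by (simp only: elementary_tensor_def tensor_product_def length_append
          length_take length_drop) simp
  next
    case False
    then show ?thesis
      by (auto simp: elementary_tensor_def tensor_product_def min_def)
  qed
qed

lemma is_sum_of_elementary_tensor_product:
  assumes "is_sum_of_elementary ds T r" "is_sum_of_elementary es U s"
  shows "is_sum_of_elementary (ds @ es) (tensor_product (length ds) T U) (r * s)"
proof -
  obtain v where v: "\<And>i. i < r \<Longrightarrow> length (v i) = length ds"
      "\<And>i j. i < r \<Longrightarrow> j < length ds \<Longrightarrow> v i ! j \<in> coord_space (ds ! j)"
      "T = (\<lambda>is. \<Sum>i<r. elementary_tensor (v i) is)"
    using assms(1) unfolding is_sum_of_elementary_def by blast
  obtain w where w: "\<And>i. i < s \<Longrightarrow> length (w i) = length es"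
      "\<And>i j. i < s \<Longrightarrow> j < length es \<Longrightarrow> w i ! j \<in> coord_space (es ! j)"
      "U = (\<lambda>is. \<Sum>i<s. elementary_tensor (w i) is)"
    using assms(2) unfolding is_sum_of_elementary_def by blast
  show ?thesis
  proof (rule is_sum_of_elementaryI[where I = "{..<r} \<times> {..<s}" and v = "\<lambda>(i, j). v i @ w j"])
    fix p k assume "p \<in> {..<r} \<times> {..<s}" "k < length (ds @ es)"
    then show "(case p of (i, j) \<Rightarrow> v i @ w j) ! k \<in> coord_space ((ds @ es) ! k)"
      using v(1,2) w(2) by (auto simp: nth_append)
  next
    fix "is"
    have "tensor_product (length ds) T U is
        = (\<Sum>(i, j)\<in>{..<r} \<times> {..<s}.
            elementary_tensor (v i) (take (length ds) is) * elementary_tensor (w j) (drop (length ds) is))"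
      by (simp add: tensor_product_def v(3) w(3) sum_product sum.cartesian_product)
    also have "\<dots> = (\<Sum>p\<in>{..<r} \<times> {..<s}. elementary_tensor (case p of (i, j) \<Rightarrow> v i @ w j) is)"
      by (rule sum.cong) (auto simp: elementary_tensor_append tensor_product_def v(1))
    finally show "tensor_product (length ds) T U is = \<dots>" .
  qed (auto simp: v(1) w(1))
qed

lemma finite_multi_indices: "finite (multi_indices ds)"
proof (rule finite_subset)
  show "multi_indices ds \<subseteq> {is. set is \<subseteq> {..<Max (set ds)} \<and> length is = length ds}"
    by (force simp: multi_indices_def in_set_conv_nth intro: less_le_trans Max_ge)
qed (simp add: finite_lists_length_eq)

text \<open>
  This guarantees that the minimum in the definition of \<open>tensor_rank\<close> is attained. The summand for
  a multi-index \<open>ks\<close> is the coefficient at \<open>ks\<close> times a product of basis vectors; the first factor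
  carries the coefficient, hence the condition \<open>ds \<noteq> []\<close>.
\<close>

lemma ex_is_sum_of_elementary:
  assumes "ds \<noteq> []" "T \<in> tensor_space ds"
  shows "\<exists>r. is_sum_of_elementary ds T r"
proof -
  define v where
    "v ks = map (\<lambda>j i. if i = ks ! j then (if j = 0 then T ks else 1) else 0) [0..<length ds]"
    for ks :: "nat list"
  have elem: "elementary_tensor (v ks) is = (if is = ks then T ks else 0)"
    if "ks \<in> multi_indices ds" for ks "is"
  proof (cases "is = ks")
    case True
    have "(\<Prod>j<length ds. if j = 0 then T ks else 1) = T ks"
      using assms(1) by (subst prod.delta) auto
    then show ?thesis
      using True that by (simp add: elementary_tensor_def v_def multi_indices_def)
  next
    case False
    show ?thesis
    proof (cases "length is = length ds")
      case True
      moreover have "length ks = length ds"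
        using that by (simp add: multi_indices_def)
      ultimately obtain j where "j < length ds" "is ! j \<noteq> ks ! j"
        using False by (metis nth_equalityI)
      then show ?thesis
        using False by (auto simp: elementary_tensor_def v_def intro!: bexI[of _ j])
    qed (use False in \<open>auto simp: elementary_tensor_def v_def\<close>)
  qed
  have "is_sum_of_elementary ds T (card (multi_indices ds))"
  proof (rule is_sum_of_elementaryI[where I = "multi_indices ds" and v = v])
    fix "is"
    have "(\<Sum>ks\<in>multi_indices ds. elementary_tensor (v ks) is)
        = (\<Sum>ks\<in>multi_indices ds. if is = ks then T ks else 0)"
      by (rule sum.cong) (simp_all add: elem)
    then show "T is = (\<Sum>ks\<in>multi_indices ds. elementary_tensor (v ks) is)"
      using assms(2) finite_multi_indices by (simp add: tensor_space_def)
  qed (use finite_multi_indices in \<open>auto simp: v_def coord_space_def multi_indices_def\<close>)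
  then show ?thesis by blast
qed

lemma is_sum_of_elementary_tensor_rank:
  assumes "ds \<noteq> []" "T \<in> tensor_space ds"
  shows "is_sum_of_elementary ds T (tensor_rank ds T)"
  unfolding tensor_rank_def using ex_is_sum_of_elementary[OF assms] by (rule LeastI_ex)

lemma is_limit_of_rank_tensor_rank:
  assumes "T \<in> tensor_space ds"
  shows "is_limit_of_rank ds T (tensor_rank ds T)"
  unfolding is_limit_of_rank_def using assms by (intro exI[of _ "\<lambda>_. T"]) auto

lemma border_rank_le:
  assumes "T \<in> tensor_space ds" "is_sum_of_elementary ds T r"
  shows "border_rank ds T \<le> r"
proof -
  have "border_rank ds T \<le> tensor_rank ds T"
    unfolding border_rank_def using is_limit_of_rank_tensor_rank[OF assms(1)] by (rule Least_le)
  also have "\<dots> \<le> r"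
    unfolding tensor_rank_def using assms(2) by (rule Least_le)
  finally show ?thesis .
qed

section \<open>A lower bound for border rank\<close>

text \<open>
  Gaussian elimination: an equation with a nonzero coefficient at the unknown \<open>l\<close> is solved for
  \<open>l\<close> and substituted into the others, which lowers both cardinalities by one.
\<close>

lemma homogeneous_system_nonzero_solution:
  fixes a :: "'i \<Rightarrow> 'j \<Rightarrow> 'a::field"
  assumes "finite I" "finite J" "card I < card J"
  shows "\<exists>x. (\<exists>j\<in>J. x j \<noteq> 0) \<and> (\<forall>i\<in>I. (\<Sum>j\<in>J. a i j * x j) = 0)"
  using assms
proof (induction I arbitrary: a J rule: finite_induct)
  case empty
  then obtain j where "j \<in> J"
    by fastforce
  then show ?case
    by (intro exI[of _ "\<lambda>_. 1"]) auto
next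
  case (insert i I)
  show ?case
  proof (cases "\<forall>j\<in>J. a i j = 0")
    case True
    have "card I < card J"
      using insert by simp
    from insert.IH[OF insert.prems(1) this, of a] True show ?thesis
      by auto
  next
    case False
    then obtain l where l: "l \<in> J" "a i l \<noteq> 0"
      by blast
    define b where "b i' j = a i' j - a i' l * a i j / a i l" for i' j
    have "card I < card (J - {l})"
      using insert l by simp
    then obtain x where x: "\<exists>j\<in>J - {l}. x j \<noteq> 0" "\<forall>i'\<in>I. (\<Sum>j\<in>J - {l}. b i' j * x j) = 0"
      using insert.IH[of "J - {l}" b] insert.prems(1) by auto
    define y where "y = x(l := - (\<Sum>j\<in>J - {l}. a i j * x j) / a i l)"
    have eq: "(\<Sum>j\<in>J. a i' j * y j) = (\<Sum>j\<in>J - {l}. b i' j * x j)" for i'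
    proof -
      have "(\<Sum>j\<in>J. a i' j * y j) = a i' l * y l + (\<Sum>j\<in>J - {l}. a i' j * x j)"
        using insert.prems(1) l(1) by (subst sum.remove[of _ l]) (auto simp: y_def intro!: sum.cong)
      also have "\<dots> = (\<Sum>j\<in>J - {l}. b i' j * x j)"
      proof -
        have "(\<Sum>j\<in>J - {l}. b i' j * x j)
            = (\<Sum>j\<in>J - {l}. a i' j * x j - a i' l / a i l * (a i j * x j))"
          by (rule sum.cong) (simp_all add: b_def left_diff_distrib)
        also have "\<dots> = (\<Sum>j\<in>J - {l}. a i' j * x j) - a i' l / a i l * (\<Sum>j\<in>J - {l}. a i j * x j)"
          by (simp only: sum_subtractf sum_distrib_left)
        finally show ?thesis
          by (simp add: y_def)
      qed
      finally show ?thesis .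
    qed
    have "b i j = 0" for j
      using l by (simp add: b_def)
    then have "\<forall>i'\<in>insert i I. (\<Sum>j\<in>J. a i' j * y j) = 0"
      using x(2) by (simp add: eq)
    moreover have "\<exists>j\<in>J. y j \<noteq> 0"
      using x(1) by (auto simp: y_def)
    ultimately show ?thesis
      by (intro exI[of _ y] conjI)
  qed
qed

text \<open>
  The Koszul flattening: contraction of the third factor of \<open>T\<close> against \<open>x \<in> \<complex>\<^sup>p \<otimes> \<complex>\<^sup>n\<close>, followed by
  the wedge product \<open>\<complex>\<^sup>p \<times> \<complex>\<^sup>p \<rightarrow> \<Lambda>\<^sup>2 \<complex>\<^sup>p\<close> of the first factor of \<open>T\<close> with that of \<open>x\<close>. The result lies
  in \<open>\<Lambda>\<^sup>2 \<complex>\<^sup>p \<otimes> \<complex>\<^sup>q\<close>; it is represented by an array antisymmetric in \<open>i\<close> and \<open>i'\<close>. For \<open>p = 3\<close> this is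
  the matrix in Strassen's determinant.
\<close>

definition koszul :: "nat \<Rightarrow> tensor \<Rightarrow> (nat \<times> nat \<Rightarrow> complex) \<Rightarrow> nat \<Rightarrow> nat \<Rightarrow> nat \<Rightarrow> complex" where
  "koszul n T x i i' j = (\<Sum>k<n. T [i, j, k] * x (i', k) - T [i', j, k] * x (i, k))"

text \<open>
  The term \<open>a \<otimes> b \<otimes> c\<close> sends \<open>x\<close> to \<open>(a \<and> x(c)) \<otimes> b\<close>, where \<open>x(c) \<in> \<complex>\<^sup>p\<close> is the contraction of \<open>x\<close>
  with \<open>c\<close>. This vanishes as soon as \<open>x(c)\<close> is parallel to \<open>a\<close>, which is \<open>p - 1\<close> linear conditions
  on the \<open>p n\<close> coordinates of \<open>x\<close>.
\<close>

lemma koszul_kernel_nontrivial: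
  assumes S: "is_sum_of_elementary [p, q, n] S m" and m: "m * (p - 1) < p * n"
  shows "\<exists>x. (\<exists>i<p. \<exists>k<n. x (i, k) \<noteq> 0) \<and> (\<forall>i<p. \<forall>i'<p. \<forall>j. koszul n S x i i' j = 0)"
proof -
  obtain v where v: "\<And>r. r < m \<Longrightarrow> length (v r) = 3"
      "S = (\<lambda>is. \<Sum>r<m. elementary_tensor (v r) is)"
    using S unfolding is_sum_of_elementary_def numeral_3_eq_3 by fastforce
  define a where "a r = v r ! 0" for r
  define b where "b r = v r ! 1" for r
  define c where "c r = v r ! 2" for r
  have S_eq: "S [i, j, k] = (\<Sum>r<m. a r i * b r j * c r k)" for i j k
    unfolding v(2) by (rule sum.cong)
      (simp_all add: elementary_tensor_def v(1) a_def b_def c_def numeral_3_eq_3 numeral_2_eq_2)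
  have "p > 0"
    using m by (cases p) auto
  \<comment> \<open>A pivot \<open>l r\<close> of \<open>a r\<close>: comparing the other coordinates with this one tests whether a vector
     is parallel to \<open>a r\<close>. If \<open>a r = 0\<close>, any pivot serves, as the equations are then trivial.\<close>
  have "\<exists>l. l < p \<and> (a r l \<noteq> 0 \<or> (\<forall>i<p. a r i = 0))" for r
    using \<open>p > 0\<close> by blast
  then obtain l where l: "\<And>r. l r < p" "\<And>r. a r (l r) \<noteq> 0 \<or> (\<forall>i<p. a r i = 0)"
    by metis
  define I where "I = (SIGMA r:{..<m}. {..<p} - {l r})"
  define J where "J = {..<p} \<times> {..<n}"
  define M where "M = (\<lambda>(r, i) (i', k).
    (a r (l r) * of_bool (i' = i) - a r i * of_bool (i' = l r)) * c r k)"
  have "card I = m * (p - 1)"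
    by (simp add: I_def card_SigmaI l(1))
  then have "card I < card J"
    using m by (simp add: J_def)
  moreover have "finite I" "finite J"
    by (auto simp: I_def J_def)
  ultimately obtain x where x: "\<exists>t\<in>J. x t \<noteq> 0" "\<forall>e\<in>I. (\<Sum>t\<in>J. M e t * x t) = 0"
    using homogeneous_system_nonzero_solution[of I J M] by blast
  define y where "y r i = (\<Sum>k<n. c r k * x (i, k))" for r i
  have M_eq: "(\<Sum>t\<in>J. M (r, i) t * x t) = a r (l r) * y r i - a r i * y r (l r)"
    if "i < p" for r i
  proof -
    have "(\<Sum>t\<in>J. M (r, i) t * x t) = (\<Sum>i'<p. \<Sum>k<n. M (r, i) (i', k) * x (i', k))"
      by (simp add: J_def sum.cartesian_product)
    also have "\<dots> = (\<Sum>i'<p. (a r (l r) * of_bool (i' = i) - a r i * of_bool (i' = l r)) * y r i')"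
      by (simp add: M_def y_def sum_distrib_left mult.assoc)
    also have "\<dots> = a r (l r) * y r i - a r i * y r (l r)"
    proof -
      have "(\<Sum>i'<p. u * of_bool (i' = h) * y r i') = u * y r h" if "h < p" for u h
        using that by (subst sum.remove[of _ h]) (auto intro!: sum.neutral)
      then show ?thesis
        using that l(1)[of r] by (simp add: left_diff_distrib sum_subtractf)
    qed
    finally show ?thesis .
  qed
  have row: "a r (l r) * y r i = a r i * y r (l r)" if "r < m" "i < p" for r i
    using x(2) M_eq[OF that(2), of r] that by (cases "i = l r") (auto simp: I_def)
  have parallel: "a r i * y r i' = a r i' * y r i" if "r < m" "i < p" "i' < p" for r i i'
  proof (cases "a r (l r) = 0")
    case True
    then show ?thesis
      using l(2)[of r] that by auto
  next
    case False
    have "a r (l r) * (a r i * y r i') = a r i * (a r (l r) * y r i')"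
      by (simp only: mult_ac)
    also have "\<dots> = a r i * (a r i' * y r (l r))"
      by (simp only: row[OF that(1,3)])
    also have "\<dots> = a r i' * (a r i * y r (l r))"
      by (simp only: mult_ac)
    also have "\<dots> = a r i' * (a r (l r) * y r i)"
      by (simp only: row[OF that(1,2)])
    also have "\<dots> = a r (l r) * (a r i' * y r i)"
      by (simp only: mult_ac)
    finally show ?thesis
      using False by simp
  qed
  have "koszul n S x i i' j = 0" if "i < p" "i' < p" for i i' j
  proof -
    have contract: "(\<Sum>k<n. S [i, j, k] * x (i', k)) = (\<Sum>r<m. b r j * (a r i * y r i'))" for i i'
      unfolding S_eq sum_distrib_right y_def sum_distrib_left
      by (subst sum.swap) (simp add: mult_ac)
    show ?thesis
      using parallel[OF _ that] by (simp add: koszul_def sum_subtractf contract)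
  qed
  moreover have "\<exists>i<p. \<exists>k<n. x (i, k) \<noteq> 0"
    using x(1) by (auto simp: J_def)
  ultimately show ?thesis by blast
qed

text \<open>
  The hypothesis on \<open>c\<close> is injectivity of the Koszul flattening in quantitative form, so that it
  survives a small perturbation of \<open>T\<close> without an appeal to compactness. If tensors of rank at most
  \<open>m\<close> approached \<open>T\<close>, a kernel vector of one that is close enough would be nearly annihilated by \<open>T\<close>,
  and its largest coordinate would violate the bound.
\<close>

lemma border_rank_gt_if_koszul_bounded_below:
  assumes T: "T \<in> tensor_space [p, q, n]" and m: "m * (p - 1) < p * n"
    and bounded_below: "\<And>x M i k. (\<And>i i' j. i < p \<Longrightarrow> i' < p \<Longrightarrow> j < q \<Longrightarrow> norm (koszul n T x i i' j) \<le> M)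
          \<Longrightarrow> i < p \<Longrightarrow> k < n \<Longrightarrow> norm (x (i, k)) \<le> c * M"
  shows "m < border_rank [p, q, n] T"
proof (rule ccontr)
  define r where "r = border_rank [p, q, n] T"
  assume "\<not> m < border_rank [p, q, n] T"
  then have "r * (p - 1) < p * n"
    using le_less_trans[OF mult_le_mono1 m] by (simp add: r_def not_less)
  have "is_limit_of_rank [p, q, n] T r"
    unfolding r_def border_rank_def by (rule LeastI, rule is_limit_of_rank_tensor_rank[OF T])
  then obtain S :: "real \<Rightarrow> tensor"
      where S: "\<forall>\<epsilon>>0. S \<epsilon> \<in> tensor_space [p, q, n] \<and> tensor_rank [p, q, n] (S \<epsilon>) = r"
      and lim: "\<forall>is. ((\<lambda>\<epsilon>. S \<epsilon> is) \<longlongrightarrow> T is) (at_right 0)"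
    unfolding is_limit_of_rank_def by blast
  \<comment> \<open>Coefficients within \<open>\<delta>\<close> change the flattening of \<open>x\<close> by at most \<open>2 n \<delta> X\<close>, with \<open>X\<close> the largest
     modulus among the coordinates of \<open>x\<close>; the choice makes \<open>2 n \<delta> c < 1\<close>.\<close>
  define \<delta> where "\<delta> = 1 / (2 * real n * (\<bar>c\<bar> + 1) + 1)"
  have den: "2 * real n * (\<bar>c\<bar> + 1) + 1 > 0"
    by (intro add_nonneg_pos mult_nonneg_nonneg) auto
  then have "\<delta> > 0"
    by (simp add: \<delta>_def)
  have "\<forall>\<^sub>F \<epsilon> in at_right 0. \<forall>is\<in>multi_indices [p, q, n]. dist (S \<epsilon> is) (T is) < \<delta>"
    using tendstoD[OF lim[rule_format] \<open>\<delta> > 0\<close>] by (intro eventually_ball_finite finite_multi_indices ballI)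
  moreover have "\<forall>\<^sub>F \<epsilon> in at_right (0::real). \<epsilon> > 0"
    by (simp add: eventually_at_right_less)
  ultimately have "\<forall>\<^sub>F \<epsilon> in at_right 0. \<epsilon> > 0 \<and> (\<forall>is\<in>multi_indices [p, q, n]. dist (S \<epsilon> is) (T is) < \<delta>)"
    by eventually_elim simp
  then obtain \<epsilon> where \<epsilon>: "\<epsilon> > 0" "\<forall>is\<in>multi_indices [p, q, n]. dist (S \<epsilon> is) (T is) < \<delta>"
    using eventually_happens'[OF trivial_limit_at_right_real] by blast
  have close: "norm (T [i, j, k] - S \<epsilon> [i, j, k]) \<le> \<delta>" if "i < p" "j < q" "k < n" for i j k
  proof -
    have "[i, j, k] \<in> multi_indices [p, q, n]"
      using that by (auto simp: multi_indices_def less_Suc_eq numeral_3_eq_3)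
    then show ?thesis
      using \<epsilon>(2)[THEN bspec, of "[i, j, k]"] by (simp add: dist_norm norm_minus_commute)
  qed
  have "is_sum_of_elementary [p, q, n] (S \<epsilon>) r"
    using is_sum_of_elementary_tensor_rank[of "[p, q, n]" "S \<epsilon>"] S \<epsilon>(1) by simp
  then obtain x where x: "\<exists>i<p. \<exists>k<n. x (i, k) \<noteq> 0"
      and ker: "\<And>i i' j. i < p \<Longrightarrow> i' < p \<Longrightarrow> koszul n (S \<epsilon>) x i i' j = 0"
    using koszul_kernel_nontrivial[OF _ \<open>r * (p - 1) < p * n\<close>] by blast
  define X where "X = Max ((norm \<circ> x) ` ({..<p} \<times> {..<n}))"
  have X: "norm (x (i, k)) \<le> X" if "i < p" "k < n" for i k
    unfolding X_def using that by (intro Max_ge) auto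
  obtain i\<^sub>0 k\<^sub>0 where max: "i\<^sub>0 < p" "k\<^sub>0 < n" "norm (x (i\<^sub>0, k\<^sub>0)) = X"
  proof -
    have "X \<in> (norm \<circ> x) ` ({..<p} \<times> {..<n})"
      unfolding X_def using x by (intro Max_in) auto
    then show ?thesis using that by auto
  qed
  have "X > 0"
  proof -
    obtain i k where "i < p" "k < n" "x (i, k) \<noteq> 0"
      using x by blast
    then show ?thesis
      using X[of i k] by (meson less_le_trans zero_less_norm_iff)
  qed
  have "norm (koszul n T x i i' j) \<le> real n * (2 * \<delta> * X)" if "i < p" "i' < p" "j < q" for i i' j
  proof -
    have "koszul n T x i i' j = koszul n T x i i' j - koszul n (S \<epsilon>) x i i' j"
      by (simp add: ker that)
    also have "\<dots> = (\<Sum>k<n. (T [i, j, k] - S \<epsilon> [i, j, k]) * x (i', k)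
                        - (T [i', j, k] - S \<epsilon> [i', j, k]) * x (i, k))"
      unfolding koszul_def sum_subtractf[symmetric] by (simp add: algebra_simps)
    also have "norm \<dots> \<le> (\<Sum>k<n. 2 * \<delta> * X)"
    proof (intro sum_norm_le)
      fix k assume k: "k \<in> {..<n}"
      have "norm ((T [i, j, k] - S \<epsilon> [i, j, k]) * x (i', k)) \<le> \<delta> * X"
        "norm ((T [i', j, k] - S \<epsilon> [i', j, k]) * x (i, k)) \<le> \<delta> * X"
        using k that close X \<open>\<delta> > 0\<close> by (auto simp: norm_mult intro!: mult_mono)
      then show "norm ((T [i, j, k] - S \<epsilon> [i, j, k]) * x (i', k)
                   - (T [i', j, k] - S \<epsilon> [i', j, k]) * x (i, k)) \<le> 2 * \<delta> * X"
        by (intro order_trans[OF norm_triangle_ineq4]) simp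
    qed
    finally show ?thesis by simp
  qed
  then have "X \<le> c * (real n * (2 * \<delta> * X))"
    using bounded_below[of x "real n * (2 * \<delta> * X)" i\<^sub>0 k\<^sub>0] max by simp
  then have "1 \<le> c * (real n * (2 * \<delta>))"
  proof -
    have "1 * X \<le> c * (real n * (2 * \<delta>)) * X"
      using \<open>X \<le> _\<close> by (simp only: mult_1 mult.assoc)
    then show ?thesis
      using \<open>X > 0\<close> by (rule mult_right_le_imp_le)
  qed
  then have "1 \<le> 2 * real n * c / (2 * real n * (\<bar>c\<bar> + 1) + 1)"
    by (simp add: \<delta>_def mult_ac)
  then have "2 * real n * (\<bar>c\<bar> + 1) + 1 \<le> 2 * real n * c"
    using den by (simp only: le_divide_eq_1_pos)
  also have "\<dots> \<le> 2 * real n * (\<bar>c\<bar> + 1)"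
    by (intro mult_left_mono) auto
  finally show False by simp
qed

section \<open>A line along which border rank drops twice\<close>

definition tensor333 :: "(nat \<Rightarrow> nat \<Rightarrow> nat \<Rightarrow> complex) \<Rightarrow> tensor" where
  "tensor333 f = (\<lambda>is. if is \<in> multi_indices [3, 3, 3] then f (is ! 0) (is ! 1) (is ! 2) else 0)"

lemma in_multi_indices_triple:
  "is \<in> multi_indices [p, q, n] \<longleftrightarrow> (\<exists>i<p. \<exists>j<q. \<exists>k<n. is = [i, j, k])"
  by (auto simp: multi_indices_def length_Suc_conv All_less_Suc)

lemma tensor333_in_tensor_space: "tensor333 f \<in> tensor_space [3, 3, 3]"
  by (simp add: tensor333_def tensor_space_def)

lemma tensor333_apply:
  "tensor333 f [i, j, k] = (if i < 3 \<and> j < 3 \<and> k < 3 then f i j k else 0)"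
  by (simp add: tensor333_def in_multi_indices_triple)

lemma tensor333_cong:
  assumes "\<And>i j k. i < 3 \<Longrightarrow> j < 3 \<Longrightarrow> k < 3 \<Longrightarrow> f i j k = g i j k"
  shows "tensor333 f = tensor333 g"
  unfolding tensor333_def using assms by (intro ext if_cong) (auto simp: in_multi_indices_triple)

lemma is_sum_of_elementary_tensor333:
  "is_sum_of_elementary [3, 3, 3] (tensor333 (\<lambda>i j k. \<Sum>r<m. a r i * b r j * c r k)) m"
proof (rule is_sum_of_elementaryI[where I = "{..<m}" and
      v = "\<lambda>r. map (\<lambda>u i. if i < 3 then u i else 0) [a r, b r, c r]"])
  fix "is"
  let ?e = "\<lambda>r. elementary_tensor (map (\<lambda>u i. if i < 3 then u i else 0) [a r, b r, c r])"
  show "tensor333 (\<lambda>i j k. \<Sum>r<m. a r i * b r j * c r k) is = (\<Sum>r<m. ?e r is)"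
  proof (cases "\<exists>i j k. is = [i, j, k]")
    case True
    then obtain i j k where "is = [i, j, k]" by blast
    moreover have "?e r [i, j, k] = (if i < 3 \<and> j < 3 \<and> k < 3 then a r i * b r j * c r k else 0)" for r
      by (simp add: elementary_tensor_def numeral_3_eq_3 numeral_2_eq_2)
    ultimately show ?thesis
      by (simp only: tensor333_apply) (auto intro!: sum.neutral)
  next
    case False
    then have "is \<notin> multi_indices [3, 3, 3]" "length is \<noteq> 3"
      by (auto simp: in_multi_indices_triple numeral_3_eq_3 length_Suc_conv)
    then show ?thesis
      by (simp add: tensor333_def elementary_tensor_def)
  qed
qed (auto simp: coord_space_def less_Suc_eq numeral_3_eq_3)

text \<open>
  Up to the row scaling \<open>p\<close> and the column scaling \<open>q\<close>, this is the pencil \<open>a \<otimes> I + b \<otimes> N\<close> with \<open>N\<close> a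
  cyclic permutation matrix. The columns of the Fourier matrix are common eigenvectors of \<open>I\<close> and
  \<open>N\<close>, so each cube root of unity gives one elementary tensor.
\<close>

lemma cyclic_pencil:
  "is_sum_of_elementary [3, 3, 3]
     (tensor333 (\<lambda>i j k. p j * q k * (a i * of_bool (k = j) + b i * of_bool (k = Suc j mod 3)))) 3"
proof -
  define \<omega> where "\<omega> = Complex (- 1 / 2) (sqrt 3 / 2)"
  have \<omega>2: "\<omega>\<^sup>2 = - 1 - \<omega>"
    by (simp add: \<omega>_def complex_eq_iff power2_eq_square)
  have \<omega>3: "\<omega> ^ 3 = 1"
  proof -
    have "\<omega> ^ 3 = \<omega> * (- 1 - \<omega>)"
      by (simp add: power3_eq_cube power2_eq_square mult.assoc flip: \<omega>2)
    also have "\<dots> = - \<omega> - \<omega>\<^sup>2"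
      by (simp add: power2_eq_square algebra_simps)
    finally show ?thesis
      by (simp add: \<omega>2)
  qed
  then have red: "\<omega> ^ n = \<omega> ^ (n mod 3)" for n
    by (metis mult_1 power_add power_mult power_one mult_div_mod_eq)
  let ?a = "\<lambda>r i. (a i + b i * \<omega> ^ (2 * r)) / 3"
  let ?b = "\<lambda>r j. p j * \<omega> ^ (2 * r * j)"
  let ?c = "\<lambda>r k. q k * \<omega> ^ (r * k)"
  have fourier: "(\<Sum>r<3. \<omega> ^ (r * n)) = (if 3 dvd n then 3 else 0)" for n
  proof -
    have "(\<Sum>r<3. \<omega> ^ (r * n)) = 1 + \<omega> ^ n + (\<omega> ^ n)\<^sup>2"
      by (simp add: numeral_3_eq_3 power_add power2_eq_square)
    also have "\<dots> = 1 + \<omega> ^ (n mod 3) + (\<omega> ^ (n mod 3))\<^sup>2"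
      by (simp only: red[of n])
    also have "\<dots> = (if 3 dvd n then 3 else 0)"
    proof -
      have "(\<omega>\<^sup>2)\<^sup>2 = \<omega>"
        using red[of 4] by (simp flip: power_mult)
      moreover have "n mod 3 = 0 \<or> n mod 3 = 1 \<or> n mod 3 = 2"
        by linarith
      ultimately show ?thesis
        by (elim disjE) (simp_all add: dvd_eq_mod_eq_0 \<omega>2)
    qed
    finally show ?thesis .
  qed
  have "tensor333 (\<lambda>i j k. p j * q k * (a i * of_bool (k = j) + b i * of_bool (k = Suc j mod 3)))
      = tensor333 (\<lambda>i j k. \<Sum>r<3. ?a r i * ?b r j * ?c r k)"
  proof (rule tensor333_cong)
    fix i j k :: nat assume jk: "j < 3" "k < 3"
    have "(\<Sum>r<3. ?a r i * ?b r j * ?c r k)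
        = p j * q k * (a i * (\<Sum>r<3. \<omega> ^ (r * (2 * j + k))) + b i * (\<Sum>r<3. \<omega> ^ (r * (2 * j + k + 2)))) / 3"
    proof -
      have "?a r i * ?b r j * ?c r k
          = p j * q k * (a i * \<omega> ^ (r * (2 * j + k)) + b i * \<omega> ^ (r * (2 * j + k + 2))) / 3" for r
      proof -
        have "\<omega> ^ (r * (2 * j + k)) = \<omega> ^ (2 * r * j) * \<omega> ^ (r * k)"
          "\<omega> ^ (r * (2 * j + k + 2)) = \<omega> ^ (2 * r * j) * \<omega> ^ (r * k) * \<omega> ^ (2 * r)"
          by (simp_all only: distrib_left power_add mult_ac)
        then show ?thesis
          by (simp only:) (simp add: algebra_simps)
      qed
      then show ?thesis
        by (simp only: sum_distrib_left sum_divide_distrib flip: sum.distrib)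
    qed
    \<comment> \<open>The factor 2 stands for \<open>-1\<close> modulo 3.\<close>
    moreover have "3 dvd 2 * j + k \<longleftrightarrow> k = j" "3 dvd 2 * j + k + 2 \<longleftrightarrow> k = Suc j mod 3"
      using jk by presburger+
    ultimately show "p j * q k * (a i * of_bool (k = j) + b i * of_bool (k = Suc j mod 3))
        = (\<Sum>r<3. ?a r i * ?b r j * ?c r k)"
      by (simp only: fourier) simp
  qed
  then show ?thesis
    using is_sum_of_elementary_tensor333[where m = 3 and a = ?a and b = ?b and c = ?c] by simp
qed

definition direction :: tensor where
  "direction = tensor333 (\<lambda>i j k. (if i = 0 then 2 else if i = 2 then 1 else 0) * of_bool (j = 2) * of_bool (k = 2))"

definition line_diagonal :: "complex \<Rightarrow> nat \<Rightarrow> nat \<Rightarrow> complex" where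
  "line_diagonal s i j = [[1, 0, 2 * s - 1], [0, 0, 0], [0, 1, s]] ! i ! j"

definition line_tensor :: "complex \<Rightarrow> tensor" where
  "line_tensor s = tensor333 (\<lambda>i j k.
     line_diagonal s i j * of_bool (k = j) + of_bool (i = 1) * of_bool (k = Suc j mod 3))"

lemma less_3_cases: "i = 0 \<or> i = 1 \<or> i = 2" if "i < 3" for i :: nat
  using that by auto

lemma line_tensor_add_direction:
  "line_tensor (s + t) is = line_tensor s is + t * direction is"
proof -
  have "line_diagonal (s + t) i j
      = line_diagonal s i j + t * ((if i = 0 then 2 else if i = 2 then 1 else 0) * of_bool (j = 2))"
    if "i < 3" "j < 3" for i j
    using less_3_cases[OF that(1)] less_3_cases[OF that(2)]
    by (auto simp: line_diagonal_def algebra_simps)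
  note diag = this
  show ?thesis
  proof (cases "is \<in> multi_indices [3, 3, 3]")
    case True
    then obtain i j k where ijk: "i < 3" "j < 3" "k < 3" "is = [i, j, k]"
      by (auto simp: in_multi_indices_triple)
    show ?thesis
      unfolding line_tensor_def direction_def ijk(4) tensor333_apply using ijk(1-3) diag[OF ijk(1,2)]
      by simp
  qed (simp add: line_tensor_def direction_def tensor333_def)
qed

lemma is_sum_of_elementary_direction: "is_sum_of_elementary [3, 3, 3] direction 1"
  unfolding direction_def
  using is_sum_of_elementary_tensor333[where m = 1 and
      a = "\<lambda>_ i. if i = 0 then 2 else if i = 2 then 1 else 0" and
      b = "\<lambda>_ j. of_bool (j = 2)" and c = "\<lambda>_ k. of_bool (k = 2)"] by simp

text \<open>
  The elementary tensor split off, with first factor \<open>b\<close>, changes the diagonal slices only in position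
  \<open>(l, l)\<close>. If this turns them into multiples of \<open>diag(p j * q j)\<close>, and the scalings \<open>p\<close> and \<open>q\<close> fix
  the cyclic slice, then \<open>cyclic_pencil\<close> applies to the rest.
\<close>

lemma is_sum_of_elementary_line_tensor:
  assumes diag: "\<And>i j. i < 3 \<Longrightarrow> j < 3 \<Longrightarrow> line_diagonal s i j = p j * q j * a i + b i * of_bool (j = l)"
    and cyc: "\<And>j. j < 3 \<Longrightarrow> p j * q (Suc j mod 3) = 1"
  shows "is_sum_of_elementary [3, 3, 3] (line_tensor s) 4"
proof -
  let ?R = "tensor333 (\<lambda>i j k. \<Sum>r<(1::nat). b i * of_bool (j = l) * of_bool (k = l))"
  let ?P = "tensor333 (\<lambda>i j k.
      p j * q k * (a i * of_bool (k = j) + of_bool (i = 1) * of_bool (k = Suc j mod 3)))"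
  have "?R is + ?P is = line_tensor s is" for "is"
  proof (cases "is \<in> multi_indices [3, 3, 3]")
    case True
    then obtain i j k where ijk: "i < 3" "j < 3" "k < 3" "is = [i, j, k]"
      by (auto simp: in_multi_indices_triple)
    have "p j * q k * of_bool (k = Suc j mod 3) = of_bool (k = Suc j mod 3)"
      using cyc[OF ijk(2)] by auto
    moreover have "line_diagonal s i j * of_bool (k = j)
        = p j * q k * a i * of_bool (k = j) + b i * of_bool (j = l) * of_bool (k = l)"
      using diag[OF ijk(1,2)] by auto
    ultimately show ?thesis
      using ijk by (simp add: line_tensor_def tensor333_apply distrib_left mult_ac)
  qed (simp add: line_tensor_def tensor333_def)
  then show ?thesis
    using is_sum_of_elementary_add[OF
       is_sum_of_elementary_tensor333[where m = 1 and a = "\<lambda>_. b" and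
          b = "\<lambda>_ j. of_bool (j = l)" and c = "\<lambda>_ k. of_bool (k = l)"]
       cyclic_pencil[of p q a "\<lambda>i. of_bool (i = 1)"]]
    by simp
qed

text \<open>
  Subtracting the elementary tensor turns one of the two diagonal slices into 0 and the other into an
  invertible matrix: \<open>diag(1, -1, -1)\<close> here, \<open>diag(2, 1, 1 / 2)\<close> for \<open>s = 1 / 2\<close>. The new entry at \<open>l\<close>
  is free; it is chosen to make the determinant 1, which is what allows scalings \<open>p\<close>, \<open>q\<close> to fix
  the cyclic slice.
\<close>

lemma is_sum_of_elementary_line_tensor_0: "is_sum_of_elementary [3, 3, 3] (line_tensor 0) 4"
  by (rule is_sum_of_elementary_line_tensor[where l = 1 and
        p = "(!) [1, -1, 1]" and q = "(!) [1, 1, -1]" and a = "(!) [1, 0, 0]" and b = "(!) [1, 0, 1]"])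
     (auto dest!: less_3_cases simp: line_diagonal_def)

lemma is_sum_of_elementary_line_tensor_half:
  "is_sum_of_elementary [3, 3, 3] (line_tensor (1 / 2)) 4"
  by (rule is_sum_of_elementary_line_tensor[where l = 0 and
        p = "(!) [2, 2, 1]" and q = "(!) [1, 1 / 2, 1 / 2]" and a = "(!) [0, 0, 1]" and b = "(!) [1, 0, -2]"])
     (auto dest!: less_3_cases simp: line_diagonal_def)

text \<open>
  The flattening of this tensor is triangular: each component is one coordinate of \<open>x\<close> or a
  difference of two, and substitution recovers every coordinate from at most three components.
\<close>

lemma border_rank_line_tensor_1: "4 < border_rank [3, 3, 3] (line_tensor 1)"
proof (rule border_rank_gt_if_koszul_bounded_below[where c = 3])
  fix x M i k
  assume small: "\<And>i i' j. i < 3 \<Longrightarrow> i' < 3 \<Longrightarrow> j < 3 \<Longrightarrow> norm (koszul 3 (line_tensor 1) x i i' j) \<le> M"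
    and "i < (3::nat)" "k < (3::nat)"
  have contract: "(\<Sum>k<3. line_tensor 1 [i, j, k] * y k)
      = line_diagonal 1 i j * y j + of_bool (i = 1) * y (Suc j mod 3)" if "i < 3" "j < 3" for i j y
  proof -
    have select: "(\<Sum>k<3. d * of_bool (k = l) * y k) = d * y l" if "l < 3" for d and l :: nat
      using that by (subst sum.remove[of _ l]) (auto intro!: sum.neutral)
    have "(\<Sum>k<3. line_tensor 1 [i, j, k] * y k)
        = (\<Sum>k<3. line_diagonal 1 i j * of_bool (k = j) * y k + of_bool (i = 1) * of_bool (k = Suc j mod 3) * y k)"
      using that by (intro sum.cong) (simp_all add: line_tensor_def tensor333_apply distrib_right)
    then show ?thesis
      using that by (simp only: sum.distrib select mod_less_divisor zero_less_numeral)
  qed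
  have koszul_eq: "koszul 3 (line_tensor 1) x i i' j
      = (line_diagonal 1 i j * x (i', j) + of_bool (i = 1) * x (i', Suc j mod 3))
        - (line_diagonal 1 i' j * x (i, j) + of_bool (i' = 1) * x (i, Suc j mod 3))"
    if "i < 3" "i' < 3" "j < 3" for i i' j
    using that by (simp only: koszul_def sum_subtractf contract)
  have ev: "norm ((line_diagonal 1 i j * x (i', j) + of_bool (i = 1) * x (i', Suc j mod 3))
        - (line_diagonal 1 i' j * x (i, j) + of_bool (i' = 1) * x (i, Suc j mod 3))) \<le> M"
    if "i < 3" "i' < 3" "j < 3" for i i' j
    using small[OF that] by (simp only: koszul_eq[OF that])
  have b1: "norm (x (2, 1)) \<le> M" using ev[of 1 2 0] by (simp add: line_diagonal_def numeral_2_eq_2)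
  have b2: "norm (x (2, 2) - x (1, 1)) \<le> M" using ev[of 1 2 1] by (simp add: line_diagonal_def numeral_2_eq_2)
  have b3: "norm (x (2, 0) - x (1, 2)) \<le> M" using ev[of 1 2 2] by (simp add: line_diagonal_def numeral_2_eq_2)
  have b4: "norm (x (2, 0)) \<le> M" using ev[of 2 0 0] by (simp add: line_diagonal_def numeral_2_eq_2)
  have b5: "norm (x (0, 1)) \<le> M" using ev[of 2 0 1] by (simp add: line_diagonal_def numeral_2_eq_2)
  have b6: "norm (x (0, 2) - x (2, 2)) \<le> M" using ev[of 2 0 2] by (simp add: line_diagonal_def numeral_2_eq_2)
  have b7: "norm (x (1, 0) - x (0, 1)) \<le> M" using ev[of 0 1 0] by (simp add: line_diagonal_def numeral_2_eq_2)
  have b8: "norm (x (0, 2)) \<le> M" using ev[of 0 1 1] by (simp add: line_diagonal_def numeral_2_eq_2)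
  have b9: "norm (x (1, 2) - x (0, 0)) \<le> M" using ev[of 0 1 2] by (simp add: line_diagonal_def numeral_2_eq_2)
  have step: "norm v \<le> (c + 1) * M" if "norm (u - v) \<le> M \<or> norm (v - u) \<le> M" "norm u \<le> c * M" for u v c
    using that norm_triangle_sub[of v u] by (auto simp: norm_minus_commute algebra_simps)
  have "norm (x (2, 2)) \<le> 2 * M" "norm (x (1, 2)) \<le> 2 * M" "norm (x (1, 0)) \<le> 2 * M"
    using step[of "x (0, 2)" "x (2, 2)" 1] step[of "x (2, 0)" "x (1, 2)" 1] step[of "x (0, 1)" "x (1, 0)" 1]
      b3 b4 b5 b6 b7 b8 by simp_all
  moreover from this have "norm (x (1, 1)) \<le> 3 * M" "norm (x (0, 0)) \<le> 3 * M"
    using step[of "x (2, 2)" "x (1, 1)" 2] step[of "x (1, 2)" "x (0, 0)" 2] b2 b9 by simp_all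
  moreover have "M \<ge> 0"
    using b1 norm_ge_zero order_trans by blast
  ultimately show "norm (x (i, k)) \<le> 3 * M"
    using \<open>i < 3\<close> \<open>k < 3\<close> b1 b4 b5 b8 by (auto dest!: less_3_cases)
qed (simp_all add: line_tensor_def tensor333_in_tensor_space)

section \<open>Strict submultiplicativity\<close>

lemma tensor_product_in_tensor_space:
  assumes "T \<in> tensor_space ds" "U \<in> tensor_space es"
  shows "tensor_product (length ds) T U \<in> tensor_space (ds @ es)"
proof -
  have "is \<in> multi_indices (ds @ es)"
    if "take (length ds) is \<in> multi_indices ds" "drop (length ds) is \<in> multi_indices es" for "is"
  proof -
    have "take (length ds) is @ drop (length ds) is \<in> multi_indices (ds @ es)"
      using that by (auto simp: multi_indices_def nth_append simp del: append_take_drop_id)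
    then show ?thesis by simp
  qed
  then show ?thesis
    using assms by (auto simp: tensor_space_def tensor_product_def)
qed

theorem theorem1p1:
  "\<exists>(ds\<^sub>1 :: nat list) (ds\<^sub>2 :: nat list) (T\<^sub>1 :: tensor) (T\<^sub>2 :: tensor).
     ds\<^sub>1 \<noteq> [] \<and> ds\<^sub>2 \<noteq> [] \<and>
     T\<^sub>1 \<in> tensor_space ds\<^sub>1 \<and> T\<^sub>2 \<in> tensor_space ds\<^sub>2 \<and>
     border_rank (ds\<^sub>1 @ ds\<^sub>2) (tensor_product (length ds\<^sub>1) T\<^sub>1 T\<^sub>2)
       < border_rank ds\<^sub>1 T\<^sub>1 * border_rank ds\<^sub>2 T\<^sub>2"
proof -
  let ?ds = "[3, 3, 3] :: nat list"
  let ?T = "line_tensor 1" and ?C = "line_tensor 0" and ?D = "line_tensor (1 / 2)"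
  have T: "?T \<in> tensor_space ?ds"
    by (simp add: line_tensor_def tensor333_in_tensor_space)
  have "is_sum_of_elementary (?ds @ ?ds)
     (\<lambda>is. tensor_product (length ?ds) ?C ?C is
        + (tensor_product (length ?ds) direction ?D is + tensor_product (length ?ds) ?D direction is))
     (4 * 4 + (1 * 4 + 4 * 1))"
    by (intro is_sum_of_elementary_add is_sum_of_elementary_tensor_product
        is_sum_of_elementary_line_tensor_0 is_sum_of_elementary_line_tensor_half
        is_sum_of_elementary_direction)
  moreover have "(\<lambda>is. tensor_product (length ?ds) ?C ?C is
        + (tensor_product (length ?ds) direction ?D is + tensor_product (length ?ds) ?D direction is))
      = tensor_product (length ?ds) ?T ?T"
  proof
    fix "is"
    have T_eq: "?T js = ?C js + direction js" and D_eq: "?D js = ?C js + direction js / 2" for js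
      using line_tensor_add_direction[of 0 1 js] line_tensor_add_direction[of 0 "1 / 2" js]
      by simp_all
    show "tensor_product (length ?ds) ?C ?C is
        + (tensor_product (length ?ds) direction ?D is + tensor_product (length ?ds) ?D direction is)
      = tensor_product (length ?ds) ?T ?T is"
      unfolding tensor_product_def T_eq D_eq by (simp add: algebra_simps)
  qed
  ultimately have "border_rank (?ds @ ?ds) (tensor_product (length ?ds) ?T ?T) \<le> 24"
    using border_rank_le[OF tensor_product_in_tensor_space[OF T T], of 24] by simp
  also have "24 < 5 * (5::nat)"
    by simp
  also have "5 * 5 \<le> border_rank ?ds ?T * border_rank ?ds ?T"
    using border_rank_line_tensor_1 by (intro mult_le_mono) auto
  finally show ?thesis
    using T by blast
qed

end
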